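(* Let $q$ be a prime power and let $k,d \in \mathbb{N}$. Let $M = (q-1)\sum_{r=0}^{d} q^{kr} = (q-1)(q^{kd+k}-1)/(q^k-1)$, and suppose that $M$ has a divisor $c \in \mathbb{N}$ such that $c < (q-1)\frac{q^k - q^{-kd}}{q^k-1}$. Then $h_q(M/c) \geq kd + k - c(q^k-1)/(q-1)$.
   Context: For a prime power $q$ and $n \in \mathbb{N}$, let $\sigma:\mathbb{F}_q^n\to\mathbb{F}_q^n$ be the cyclic shift $\sigma(\sum_{i=1}^n x_i e_i)=\sum_{i=1}^n x_{i-1}e_i$ (indices mod $n$), where $e_1,\dots,e_n$ is the standard basis. A subspace $U\le \mathbb{F}_q^n$ is cyclically covering if $\bigcup_{r=0}^{n-1}\sigma^r(U)=\mathbb{F}_q^n$. $h_q(n)$ denotes the maximum possible codimension of a cyclically covering subspace of $\mathbb{F}_q^n$. *)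

theory Defs
  imports Complex_Main "HOL-Library.Cardinality" "Jordan_Normal_Form.VS_Connect"
begin

(* Coordinates are numbered 0, ..., n - 1: entry i of the shifted vector is entry i - 1 (mod n)
   of v. Adding dim_vec v first keeps the natural-number subtraction from truncating at i = 0. *)
definition cyclic_shift :: "'a vec \<Rightarrow> 'a vec" where
  "cyclic_shift v = vec (dim_vec v) (\<lambda>i. v $ ((i + dim_vec v - 1) mod dim_vec v))"

definition cyclically_covering :: "nat \<Rightarrow> 'a :: field vec set \<Rightarrow> bool" where
  "cyclically_covering n U \<longleftrightarrow>
     VectorSpace.subspace class_ring U (module_vec TYPE('a) n) \<and>
     (\<Union>r\<in>{0..<n}. (cyclic_shift ^^ r) ` U) = carrier_vec n"

definition codim_vec :: "nat \<Rightarrow> 'a :: field vec set \<Rightarrow> nat" where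
  "codim_vec n U =
     n - vectorspace.dim (class_ring :: 'a ring) ((module_vec TYPE('a) n)\<lparr>carrier := U\<rparr>)"

(* h_q(n), where q is the cardinality of the finite field 'a; the finite field of order q is
   unique up to isomorphism. For n >= 1 the maximum is over a nonempty set, since the whole space
   is cyclically covering, and this set is contained in {..n}. *)
definition max_cyclic_codim :: "'a :: {field, finite} itself \<Rightarrow> nat \<Rightarrow> nat" where
  "max_cyclic_codim _ n = Max {codim_vec n U | U :: 'a vec set. cyclically_covering n U}"

end

theory Submission
  imports Defs "HOL-Algebra.Algebraic_Closure_Type" "HOL-Number_Theory.Residues"
begin

text \<open>
  Let \<open>N = k * d + k\<close>, \<open>n = M / c\<close> and \<open>t = c * (q ^ k - 1) / (q - 1)\<close>, so that
  \<open>n * t = q ^ N - 1\<close>. If \<open>g\<close> generates the multiplicative group of the field \<open>K\<close> with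
  \<open>q ^ N\<close> elements, then \<open>\<gamma> = g ^ t\<close> has order \<open>n\<close>, and under the linear map
  \<open>v \<mapsto> (\<Sum>i<n. v\<^sub>i * \<gamma> ^ i)\<close> the cyclic shift becomes multiplication by \<open>\<gamma>\<close>. The span of
  \<open>1, g, \<dots>, g ^ (t - 1)\<close> meets every coset of the group generated by \<open>\<gamma>\<close>, so its preimage is
  cyclically covering. The bound on \<open>c\<close> means \<open>n > q ^ (k * d)\<close>; for \<open>d > 0\<close> this
  prevents \<open>\<gamma>\<close> from lying in a proper subfield of \<open>K\<close>, so the map is onto \<open>K\<close> and the
  preimage has codimension at least \<open>N - t\<close>. For \<open>d = 0\<close> the claimed bound is not positive.
\<close>

section \<open>The finite base field and its Frobenius map\<close>

lemma one_less_card_field: "1 < CARD('a :: {field, finite})"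
  using card_mono[of UNIV "{0, 1 :: 'a}"] by simp

text \<open>Multiplication by a nonzero \<open>x\<close> permutes the nonzero elements, so it fixes
  their product; cancelling that product leaves \<open>x ^ (q - 1) = 1\<close>.\<close>

lemma power_card_eq_same:
  fixes x :: "'a :: {field, finite}"
  shows "x ^ CARD('a) = x"
proof (cases "x = 0")
  case False
  let ?P = "\<Prod>y\<in>UNIV - {0 :: 'a}. y"
  have "(\<Prod>y\<in>UNIV - {0}. x * y) = ?P"
    by (rule prod.reindex_bij_witness[of _ "\<lambda>y. y / x" "\<lambda>y. x * y"]) (use False in auto)
  then have "x ^ (CARD('a) - 1) * ?P = ?P"
    by (simp add: prod.distrib card_Diff_singleton)
  moreover have "?P \<noteq> 0"
    by simp
  ultimately have "x ^ (CARD('a) - 1) = 1"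
    by simp
  then have "x * x ^ (CARD('a) - 1) = x"
    by simp
  then show ?thesis
    by (simp flip: power_Suc)
qed (simp add: zero_power)

lemma of_nat_card_alg_closure: "of_nat CARD('a) = (0 :: 'a :: {field, finite} alg_closure)"
  using CHAR_dvd_CARD[where 'a = 'a] by (simp add: of_nat_eq_0_iff_char_dvd)

text \<open>
  For fixed \<open>y\<close>, the polynomial \<open>(X + y) ^ q - X ^ q - y ^ q\<close> has degree less than \<open>q\<close>.
  If \<open>y\<close> lies in the base field it vanishes on the \<open>q\<close> elements of the base field, hence
  identically; exchanging the variables then gives the claim for arbitrary \<open>y\<close>.
\<close>
lemma frobenius_add:
  fixes x y :: "'a :: {field, finite} alg_closure"
  shows "(x + y) ^ CARD('a) = x ^ CARD('a) + y ^ CARD('a)"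
proof -
  let ?q = "CARD('a)"
  let ?F = "range (to_ac :: 'a \<Rightarrow> 'a alg_closure)"
  have card_F: "card ?F = ?q"
    by (simp add: card_image inj_to_ac)
  have pow_F: "z ^ ?q = z" if "z \<in> ?F" for z
    using that by (auto simp: power_card_eq_same simp flip: to_ac_power)
  have add_F: "z + w \<in> ?F" if "z \<in> ?F" "w \<in> ?F" for z w
    using that by (auto simp flip: to_ac_add)
  have ext: "(z + y) ^ ?q = z ^ ?q + y ^ ?q"
    if "\<And>w. w \<in> ?F \<Longrightarrow> (w + y) ^ ?q = w ^ ?q + y ^ ?q" for y z :: "'a alg_closure"
  proof -
    have "[:y, 1:] ^ ?q = Polynomial.monom 1 ?q + [:y ^ ?q:]"
    proof (rule poly_eqI_degree_lead_coeff[where n = ?q and A = ?F])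
      show "poly.coeff ([:y, 1:] ^ ?q) ?q = poly.coeff (Polynomial.monom 1 ?q + [:y ^ ?q:]) ?q"
        by (simp add: coeff_linear_power coeff_pCons split: nat.splits)
      show "Polynomial.degree ([:y, 1:] ^ ?q) \<le> ?q"
        by (simp add: degree_linear_power)
      show "Polynomial.degree (Polynomial.monom 1 ?q + [:y ^ ?q:]) \<le> ?q"
        by (rule degree_add_le) (auto simp: degree_monom_le)
      show "poly ([:y, 1:] ^ ?q) w = poly (Polynomial.monom 1 ?q + [:y ^ ?q:]) w" if "w \<in> ?F" for w
        using \<open>\<And>w. w \<in> ?F \<Longrightarrow> (w + y) ^ ?q = w ^ ?q + y ^ ?q\<close>[OF that]
        by (simp add: poly_monom add.commute)
    qed (simp add: card_F)
    from arg_cong[OF this, of "\<lambda>p. poly p z"] show ?thesis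
      by (simp add: poly_monom add.commute)
  qed
  have "(z + w) ^ ?q = z ^ ?q + w ^ ?q" if "w \<in> ?F" for z w
    by (rule ext) (use that in \<open>simp add: pow_F add_F\<close>)
  then have "(w + y) ^ ?q = w ^ ?q + y ^ ?q" if "w \<in> ?F" for w
    using that by (metis add.commute)
  then show ?thesis
    by (rule ext)
qed

lemma frobenius_power_add:
  fixes x y :: "'a :: {field, finite} alg_closure"
  shows "(x + y) ^ (CARD('a) ^ N) = x ^ (CARD('a) ^ N) + y ^ (CARD('a) ^ N)"
  by (induction N arbitrary: x y) (simp_all add: power_mult frobenius_add)

section \<open>The field with q^N elements inside the algebraic closure\<close>

text \<open>The fixed points of the \<open>N\<close>-th iterate of Frobenius, so closure under
  addition is additivity of Frobenius. For \<open>N = 0\<close> this is the whole closure, which is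
  why the counting results assume \<open>N > 0\<close>.\<close>

definition extension_field :: "nat \<Rightarrow> 'a :: {field, finite} alg_closure set" where
  "extension_field N = {x. x ^ (CARD('a) ^ N) = x}"

lemma extension_field_0 [simp]: "0 \<in> extension_field N"
  by (simp add: extension_field_def zero_power)

lemma extension_field_1 [simp]: "1 \<in> extension_field N"
  by (simp add: extension_field_def)

lemma extension_field_add:
  "x \<in> extension_field N \<Longrightarrow> y \<in> extension_field N \<Longrightarrow> x + y \<in> extension_field N"
  by (simp add: extension_field_def frobenius_power_add)

lemma extension_field_mult:
  "x \<in> extension_field N \<Longrightarrow> y \<in> extension_field N \<Longrightarrow> x * y \<in> extension_field N"
  by (simp add: extension_field_def power_mult_distrib)

lemma extension_field_power: "x \<in> extension_field N \<Longrightarrow> x ^ m \<in> extension_field N"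
  by (induction m) (auto intro: extension_field_mult)

lemma extension_field_inverse: "x \<in> extension_field N \<Longrightarrow> inverse x \<in> extension_field N"
  by (simp add: extension_field_def power_inverse)

lemma extension_field_sum:
  "(\<And>i. i \<in> A \<Longrightarrow> f i \<in> extension_field N) \<Longrightarrow> sum f A \<in> extension_field N"
  by (induction A rule: infinite_finite_induct) (auto intro: extension_field_add)

lemma extension_field_to_ac: "to_ac a \<in> extension_field N"
proof -
  have "a ^ (CARD('a) ^ N) = a"
    by (induction N) (simp_all add: power_mult power_card_eq_same)
  then show ?thesis
    by (simp add: extension_field_def flip: to_ac_power)
qed

lemma extension_field_uminus: "x \<in> extension_field N \<Longrightarrow> - x \<in> extension_field N"
  using extension_field_mult[OF extension_field_to_ac[of "-1"]] by simp fastforce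

text \<open>The set consists of the roots of \<open>X ^ Q - X\<close>, which splits over the
  closure. Since \<open>Q\<close> vanishes in characteristic \<open>p\<close>, the derivative is
  \<open>-1\<close>, so every root is simple and there are exactly \<open>Q\<close> of them.\<close>

lemma card_extension_field:
  assumes "N > 0"
  shows "card (extension_field N :: 'a :: {field, finite} alg_closure set) = CARD('a) ^ N"
proof -
  let ?Q = "CARD('a) ^ N"
  define p :: "'a alg_closure poly" where "p = Polynomial.monom 1 ?Q - Polynomial.monom 1 1"
  have Q: "?Q > 1"
    using one_less_card_field assms by (rule one_less_power)
  have coeff_p: "poly.coeff p ?Q = 1" "poly.coeff p i = 0" if "i > ?Q" for i
    using Q that by (auto simp: p_def)
  have "p \<noteq> 0"
    using coeff_p(1)[of "Suc ?Q"] by auto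
  have "Polynomial.degree p = ?Q"
    using coeff_p(1)[of "Suc ?Q"] coeff_p(2) by (intro antisym degree_le le_degree) auto
  have roots: "{x. poly p x = 0} = extension_field N"
    by (auto simp: p_def poly_monom extension_field_def)
  have "of_nat ?Q = (0 :: 'a alg_closure)"
    using assms by (simp add: of_nat_card_alg_closure zero_power)
  then have "pderiv p = [:-1:]"
    by (simp add: p_def pderiv_diff pderiv_monom one_pCons flip: of_nat_power)
  have order: "order a p = 1" if "poly p a = 0" for a
  proof (rule ccontr)
    assume "order a p \<noteq> 1"
    with that \<open>p \<noteq> 0\<close> have "2 \<le> order a p"
      using order_root[of p a] by linarith
    then have "[:- a, 1:] ^ 2 dvd p"
      using order_divides by blast
    then obtain r where "p = [:- a, 1:] * ([:- a, 1:] * r)"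
      by (metis dvdE mult.assoc power2_eq_square)
    then have "poly (pderiv p) a = 0"
      by (simp add: pderiv_mult del: mult_pCons_left)
    with \<open>pderiv p = [:-1:]\<close> show False
      by simp
  qed
  obtain A where A: "size A = Polynomial.degree p"
    "p = Polynomial.smult (poly.coeff p (Polynomial.degree p)) (\<Prod>x\<in>#A. [:- x, 1:])"
    using alg_closed_imp_factorization[OF \<open>p \<noteq> 0\<close>] by blast
  have "proots (\<Prod>x\<in>#B. [:- x, 1:]) = B" for B :: "'a alg_closure multiset"
    by (induction B) (simp_all add: proots_mult prod_mset_zero_iff image_iff del: mult_pCons_left)
  then have "proots p = A"
    using \<open>p \<noteq> 0\<close> by (subst A(2)) simp
  then have "size (proots p) = ?Q"
    using A \<open>Polynomial.degree p = ?Q\<close> by simp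
  \<comment> \<open>All multiplicities are one, so the root multiset and its underlying set have the
    same size.\<close>
  moreover have "size (proots p) = card (set_mset (proots p))"
    using \<open>p \<noteq> 0\<close> by (simp add: size_multiset_overloaded_eq order)
  ultimately show ?thesis
    using \<open>p \<noteq> 0\<close> by (simp add: roots)
qed

text \<open>Packaging the set as an algebraic field structure gives access to the cyclicity of the
  multiplicative group of a finite field.\<close>

lemma extension_field_generator:
  assumes "N > 0"
  obtains g where "extension_field N - {0 :: 'a :: {field, finite} alg_closure} = range (\<lambda>i. g ^ i)"
proof -
  let ?K = "extension_field N :: 'a alg_closure set"
  define R where "R = (class_ring :: 'a alg_closure ring) \<lparr>carrier := ?K\<rparr>"
  have R: "carrier R = ?K" "monoid.mult R = (*)" "one R = 1" "ring.zero R = 0" "add R = (+)"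
    by (simp_all add: R_def)
  have inv: "\<exists>y\<in>?K. x * y = 1" if "x \<in> ?K" "x \<noteq> 0" for x
    using extension_field_inverse[OF that(1)] that(2) by (intro bexI[of _ "inverse x"]) auto
  have neg: "\<exists>y\<in>?K. x + y = 0" if "x \<in> ?K" for x
    using extension_field_uminus[OF that] by (intro bexI[of _ "- x"]) auto
  interpret R: field R
    by unfold_locales
      (auto simp: R algebra_simps Units_def extension_field_add extension_field_mult inv neg)
  have pow: "a [^]\<^bsub>R\<^esub> i = a ^ i" for a and i :: nat
    by (induction i) (simp_all add: R mult.commute)
  have "finite ?K"
    using card_extension_field[OF assms, where 'a = 'a] by (simp add: card_ge_0_finite)
  with R.finite_field_mult_group_has_gen R obtain g where
    "carrier (mult_of R) = {g [^]\<^bsub>R\<^esub> i | i::nat. i \<in> UNIV}"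
    by auto
  then have "?K - {0} = range (\<lambda>i. g ^ i)"
    by (auto simp: R pow)
  then show ?thesis
    by (rule that)
qed

section \<open>Iterated shifts and counting in coordinate spaces\<close>

text \<open>Each shift moves the index back by one; modulo \<open>n\<close> this is adding
  \<open>n - 1\<close>, which avoids truncated subtraction.\<close>

lemma funpow_cyclic_shift:
  assumes "v \<in> carrier_vec n"
  shows "(cyclic_shift ^^ r) v = vec n (\<lambda>i. v $ ((i + r * (n - 1)) mod n))"
proof (induction r)
  case 0
  show ?case
    using assms by auto
next
  case (Suc r)
  have "((i + n - 1) mod n + r * (n - 1)) mod n = (i + Suc r * (n - 1)) mod n" if "i < n" for i
    using that by (simp add: mod_add_left_eq add.assoc)
  then show ?case
    unfolding funpow.simps comp_apply Suc by (intro eq_vecI) (simp_all add: cyclic_shift_def)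
qed

lemma cyclic_shift_carrier: "v \<in> carrier_vec n \<Longrightarrow> cyclic_shift v \<in> carrier_vec n"
  by (auto simp: cyclic_shift_def)

lemma funpow_cyclic_shift_carrier: "v \<in> carrier_vec n \<Longrightarrow> (cyclic_shift ^^ r) v \<in> carrier_vec n"
  by (induction r) (auto intro: cyclic_shift_carrier)

lemma funpow_cyclic_shift_dim:
  assumes "v \<in> carrier_vec n"
  shows "(cyclic_shift ^^ n) v = v"
  using assms by (auto simp: funpow_cyclic_shift)

lemma card_carrier_vec: "card (carrier_vec n :: 'a :: finite vec set) = CARD('a) ^ n"
proof -
  have "bij_betw vec_of_list {xs :: 'a list. set xs \<subseteq> UNIV \<and> length xs = n} (carrier_vec n)"
    by (rule bij_betwI[where g = list_of_vec]) (auto simp: list_vec vec_list carrier_vecD intro: carrier_vecI)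
  then show ?thesis
    using card_lists_length_eq[of "UNIV :: 'a set" n] by (metis bij_betw_same_card finite)
qed

lemma finite_carrier_vec: "finite (carrier_vec n :: 'a :: finite vec set)"
  by (rule card_ge_0_finite) (simp add: card_carrier_vec)

text \<open>Coefficient functions on a basis correspond bijectively to vectors of \<open>U\<close>.
  This turns the later dimension bound into a bound on cardinalities.\<close>

lemma card_subspace:
  fixes U :: "'a :: {field, finite} vec set"
  assumes "VectorSpace.subspace class_ring U (module_vec TYPE('a) n)"
  shows "card U = CARD('a) ^ vectorspace.dim (class_ring :: 'a ring) ((module_vec TYPE('a) n)\<lparr>carrier := U\<rparr>)"
proof -
  interpret V: vectorspace "class_ring :: 'a ring" "module_vec TYPE('a) n"
    by (rule vec_vs)
  interpret U: vectorspace "class_ring :: 'a ring" "(module_vec TYPE('a) n)\<lparr>carrier := U\<rparr>"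
    using V.subspace_is_vs[OF assms] .
  have "U \<subseteq> carrier_vec n"
    using submodule.subset[OF V.is_module[OF assms]] by (simp add: module_vec_simps)
  then have "finite U"
    using finite_carrier_vec by (rule finite_subset)
  \<comment> \<open>The finite set \<open>U\<close> is a spanning set of itself.\<close>
  then have "U.fin_dim"
    unfolding U.fin_dim_def using U.span_is_subset2 U.in_own_span
    by (intro exI[of _ U]) (auto intro!: antisym)
  then obtain B where B: "finite B" "U.basis B"
    using U.finite_basis_exists by blast
  then have "B \<subseteq> U"
    by (simp add: U.basis_def)
  have "bij_betw (\<lambda>a. U.lincomb a B) (B \<rightarrow>\<^sub>E (UNIV :: 'a set)) U"
  proof -
    have ex1: "\<exists>!a. a \<in> B \<rightarrow>\<^sub>E (UNIV :: 'a set) \<and> U.lincomb a B = v" if "v \<in> U" for v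
      using U.basis_criterion[of B] B \<open>B \<subseteq> U\<close> that by simp
    have "U.lincomb a B \<in> U" for a
      using U.lincomb_closed[of B a] \<open>B \<subseteq> U\<close> by simp
    with ex1 show ?thesis
      unfolding bij_betw_def inj_on_def by (auto simp: image_iff) metis+
  qed
  then have "card U = card (B \<rightarrow>\<^sub>E (UNIV :: 'a set))"
    by (simp add: bij_betw_same_card)
  also have "\<dots> = CARD('a) ^ card B"
    using B by (simp add: card_PiE)
  also have "card B = U.dim"
    using U.dim_basis B by simp
  finally show ?thesis .
qed

lemma max_cyclic_codim_ge:
  assumes "cyclically_covering n U"
  shows "codim_vec n (U :: 'a :: {field, finite} vec set) \<le> max_cyclic_codim TYPE('a) n"
  unfolding max_cyclic_codim_def
proof (rule Max_ge)
  have "{codim_vec n U |U :: 'a vec set. cyclically_covering n U} \<subseteq> {..n}"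
    by (auto simp: codim_vec_def)
  then show "finite {codim_vec n U |U :: 'a vec set. cyclically_covering n U}"
    by (rule finite_subset) simp
qed (use assms in blast)

section \<open>The evaluation map and its image\<close>

text \<open>The value at \<open>\<gamma>\<close> of the polynomial with coefficient vector
  \<open>v\<close>. It is used both at an \<open>n\<close>-th root of unity, on vectors of length
  \<open>n\<close>, and at a field generator, on vectors of length \<open>t\<close>.\<close>

definition eval_vec :: "'a :: field alg_closure \<Rightarrow> 'a vec \<Rightarrow> 'a alg_closure" where
  "eval_vec \<gamma> v = (\<Sum>i<dim_vec v. to_ac (v $ i) * \<gamma> ^ i)"

lemma eval_vec_add:
  "v \<in> carrier_vec n \<Longrightarrow> w \<in> carrier_vec n \<Longrightarrow> eval_vec \<gamma> (v + w) = eval_vec \<gamma> v + eval_vec \<gamma> w"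
  by (simp add: eval_vec_def algebra_simps sum.distrib)

lemma eval_vec_smult: "eval_vec \<gamma> (a \<cdot>\<^sub>v v) = to_ac a * eval_vec \<gamma> v"
  by (simp add: eval_vec_def sum_distrib_left mult.assoc)

lemma eval_vec_zero [simp]: "eval_vec \<gamma> (0\<^sub>v n) = 0"
  by (simp add: eval_vec_def)

lemma eval_vec_unit: "i < n \<Longrightarrow> eval_vec \<gamma> (unit_vec n i) = \<gamma> ^ i"
  by (simp add: eval_vec_def unit_vec_def if_distrib[of to_ac] if_distrib[of "\<lambda>x. x * _"]
      sum.delta cong: if_cong)

text \<open>The shift is multiplication by \<open>X\<close> modulo \<open>X ^ n - 1\<close>, and
  \<open>\<gamma>\<close> is a root of the modulus.\<close>

lemma eval_vec_cyclic_shift: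
  assumes "\<gamma> ^ n = 1" "v \<in> carrier_vec n"
  shows "eval_vec \<gamma> (cyclic_shift v) = \<gamma> * eval_vec \<gamma> v"
proof (cases n)
  case 0
  then show ?thesis
    using assms by (simp add: eval_vec_def cyclic_shift_def)
next
  case (Suc m)
  have "eval_vec \<gamma> (cyclic_shift v) = (\<Sum>i<Suc m. to_ac (v $ ((i + m) mod Suc m)) * \<gamma> ^ i)"
    using assms Suc by (simp add: eval_vec_def cyclic_shift_def)
  \<comment> \<open>The summand at \<open>i = 0\<close> holds the wrapped top entry; its factor 1 is
    rewritten as \<open>\<gamma> ^ Suc m\<close>.\<close>
  also have "\<dots> = to_ac (v $ m) * \<gamma> ^ Suc m + (\<Sum>i<m. to_ac (v $ i) * \<gamma> ^ Suc i)"
  proof -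
    have "(Suc i + m) mod Suc m = i" if "i < m" for i
      using that mod_add_self2[of i "Suc m"] by simp
    then show ?thesis
      using assms(1) Suc by (simp add: sum.lessThan_Suc_shift del: sum.lessThan_Suc power_Suc)
  qed
  also have "\<dots> = \<gamma> * eval_vec \<gamma> v"
    using assms Suc by (simp add: eval_vec_def sum_distrib_left algebra_simps)
  finally show ?thesis .
qed

lemma eval_vec_funpow_cyclic_shift:
  assumes "\<gamma> ^ n = 1" "v \<in> carrier_vec n"
  shows "eval_vec \<gamma> ((cyclic_shift ^^ r) v) = \<gamma> ^ r * eval_vec \<gamma> v"
  by (induction r)
    (simp_all add: eval_vec_cyclic_shift[OF assms(1)] funpow_cyclic_shift_carrier[OF assms(2)] mult.assoc)

lemma eval_vec_in_extension_field:
  "\<gamma> \<in> extension_field N \<Longrightarrow> eval_vec \<gamma> v \<in> extension_field N"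
  unfolding eval_vec_def
  by (intro extension_field_sum extension_field_mult extension_field_to_ac extension_field_power)

text \<open>Expanding \<open>x\<close> in powers of \<open>\<gamma>\<close> suffices: each
  \<open>\<gamma> ^ i * y\<close> is the value of a shifted vector, and the image is closed under
  linear combinations.\<close>

lemma eval_vec_image_mult:
  assumes "\<gamma> ^ n = 1" "x \<in> eval_vec \<gamma> ` carrier_vec n" "y \<in> eval_vec \<gamma> ` carrier_vec n"
  shows "x * y \<in> eval_vec \<gamma> ` carrier_vec n"
proof -
  let ?S = "eval_vec \<gamma> ` carrier_vec n"
  have zero: "0 \<in> ?S"
    by (rule image_eqI[of _ _ "0\<^sub>v n"]) auto
  have add: "a + b \<in> ?S" if "a \<in> ?S" "b \<in> ?S" for a b
    using that by (auto simp flip: eval_vec_add)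
  have scale: "to_ac c * (\<gamma> ^ i * y) \<in> ?S" for c i
    using assms(3)
    by (auto simp flip: eval_vec_smult eval_vec_funpow_cyclic_shift[OF assms(1)]
        intro!: imageI funpow_cyclic_shift_carrier)
  obtain v where v: "v \<in> carrier_vec n" "x = eval_vec \<gamma> v"
    using assms(2) by blast
  have "x * y = (\<Sum>i<n. to_ac (v $ i) * (\<gamma> ^ i * y))"
    using v by (simp add: eval_vec_def sum_distrib_right mult.assoc)
  also have "sum f A \<in> ?S" if "\<And>i. f i \<in> ?S" for f :: "nat \<Rightarrow> _" and A
    by (induction A rule: infinite_finite_induct) (auto simp: zero that intro: add)
  then have "(\<Sum>i<n. to_ac (v $ i) * (\<gamma> ^ i * y)) \<in> ?S"
    by this (rule scale)
  finally show ?thesis .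
qed

section \<open>Powers of a generator and surjectivity of evaluation\<close>

text \<open>Exponents reduce modulo \<open>q ^ N - 1\<close>, so the first \<open>q ^ N - 1\<close>
  powers already exhaust the equally many nonzero elements and cannot repeat.\<close>

lemma extension_field_generator_inj:
  fixes g :: "'a :: {field, finite} alg_closure"
  assumes "N > 0" and gen: "extension_field N - {0} = range (\<lambda>i. g ^ i)"
  shows "g ^ (CARD('a) ^ N - 1) = 1"
    and "inj_on (\<lambda>i. g ^ i) {..<CARD('a) ^ N - 1}"
proof -
  let ?Q = "CARD('a) ^ N"
  have "g ^ 1 \<in> extension_field N - {0}"
    unfolding gen by blast
  then have g: "g ^ ?Q = g" "g \<noteq> 0"
    by (auto simp: extension_field_def)
  have "g * g ^ (?Q - 1) = g * 1"
    using g by (simp flip: power_Suc)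
  then show pow: "g ^ (?Q - 1) = 1"
    using g(2) by (metis mult_left_cancel)
  have card: "card (range (\<lambda>i. g ^ i)) = ?Q - 1"
    using card_extension_field[OF assms(1), where 'a = 'a] by (simp flip: gen)
  have "?Q - 1 > 0"
    using one_less_power[OF one_less_card_field assms(1), where 'a1 = 'a] by simp
  have "(\<lambda>i. g ^ i) ` {..<?Q - 1} = range (\<lambda>i. g ^ i)"
  proof safe
    fix i
    have "g ^ i = g ^ ((?Q - 1) * (i div (?Q - 1)) + i mod (?Q - 1))"
      by simp
    also have "\<dots> = g ^ (i mod (?Q - 1))"
      by (simp only: power_add power_mult pow) simp
    finally show "g ^ i \<in> (\<lambda>i. g ^ i) ` {..<?Q - 1}"
      using \<open>?Q - 1 > 0\<close> by auto
  qed simp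
  then show "inj_on (\<lambda>i. g ^ i) {..<?Q - 1}"
    using card by (intro eq_card_imp_inj_on) auto
qed

text \<open>
  The image \<open>S\<close> is a field with more than \<open>n\<close> elements. If \<open>y\<close> lay outside it, the elements
  \<open>a + b * y\<close> with \<open>a, b \<in> S\<close> would be pairwise distinct.
\<close>
lemma eval_vec_image_eq_extension_field:
  fixes \<gamma> :: "'a :: {field, finite} alg_closure"
  assumes "N > 0" "n > 0" "\<gamma> \<in> extension_field N" and pow: "\<gamma> ^ n = 1"
    and inj: "inj_on (\<lambda>i. \<gamma> ^ i) {..<n}"
    and large: "CARD('a) ^ N \<le> n ^ 2"
  shows "eval_vec \<gamma> ` carrier_vec n = extension_field N"
proof (rule ccontr)
  let ?S = "eval_vec \<gamma> ` carrier_vec n"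
  let ?K = "extension_field N :: 'a alg_closure set"
  assume neq: "?S \<noteq> ?K"
  have "?S \<subseteq> ?K"
    using assms(3) by (auto intro: eval_vec_in_extension_field)
  with neq obtain y where y: "y \<in> ?K" "y \<notin> ?S"
    by blast
  have fin: "finite ?K"
    by (rule card_ge_0_finite) (simp add: card_extension_field assms(1))
  have mult: "a * b \<in> ?S" if "a \<in> ?S" "b \<in> ?S" for a b
    using eval_vec_image_mult[OF pow that] .
  have diff: "a - b \<in> ?S" if "a \<in> ?S" "b \<in> ?S" for a b
  proof -
    from that obtain v w where vw: "v \<in> carrier_vec n" "w \<in> carrier_vec n"
      "a = eval_vec \<gamma> v" "b = eval_vec \<gamma> w"
      by blast
    then have "a - b = eval_vec \<gamma> (v + (-1) \<cdot>\<^sub>v w)"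
      by (subst eval_vec_add[of _ n]) (auto simp: eval_vec_smult)
    with vw show ?thesis
      by (intro image_eqI[of _ _ "v + (-1) \<cdot>\<^sub>v w"]) auto
  qed
  have powers: "\<gamma> ^ i \<in> ?S" if "i < n" for i
    using that by (intro image_eqI[of _ _ "unit_vec n i"]) (simp_all add: eval_vec_unit)
  have one: "1 \<in> ?S"
    using powers[of 0] assms(2) by simp
  have power: "a ^ m \<in> ?S" if "a \<in> ?S" for a m
    by (induction m) (auto intro: one mult that)
  \<comment> \<open>From \<open>a ^ Q = a\<close> with \<open>Q = m + 2\<close>, the inverse is the
    power \<open>a ^ m\<close>, so closure under products is enough.\<close>
  have inverse: "inverse a \<in> ?S" if "a \<in> ?S" "a \<noteq> 0" for a
  proof -
    have "CARD('a) ^ N > 1"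
      using one_less_card_field assms(1) by (rule one_less_power)
    then obtain m where m: "CARD('a) ^ N = Suc (Suc m)"
      by (auto simp: less_iff_Suc_add)
    have "a * (a * a ^ m) = a * 1"
      using that \<open>?S \<subseteq> ?K\<close> by (auto simp: extension_field_def m)
    then have "a * a ^ m = 1"
      using that(2) by (metis mult_left_cancel)
    then have "inverse a = a ^ m"
      by (rule inverse_unique)
    then show ?thesis
      using power[OF that(1)] by simp
  qed
  have "inj_on (\<lambda>(a, b). a + b * y) (?S \<times> ?S)"
  proof (rule inj_onI, clarsimp simp del: mult_cancel_right, goal_cases)
    case (1 v w v' w')
    have "eval_vec \<gamma> w = eval_vec \<gamma> w'"
    proof (rule ccontr)
      let ?d = "eval_vec \<gamma> w - eval_vec \<gamma> w'"
      assume "eval_vec \<gamma> w \<noteq> eval_vec \<gamma> w'"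
      \<comment> \<open>A collision with different coefficients of \<open>y\<close> could be solved
        for \<open>y\<close> inside \<open>?S\<close>.\<close>
      then have "y = (eval_vec \<gamma> v' - eval_vec \<gamma> v) * inverse ?d"
        using 1 by (simp add: field_simps)
      also have "\<dots> \<in> ?S"
        using 1 \<open>eval_vec \<gamma> w \<noteq> eval_vec \<gamma> w'\<close> by (intro mult inverse diff) auto
      finally show False
        using y by simp
    qed
    with 1 show ?case
      by simp
  qed
  moreover have "(\<lambda>(a, b). a + b * y) ` (?S \<times> ?S) \<subseteq> ?K"
    using \<open>?S \<subseteq> ?K\<close> y by (auto intro!: extension_field_add extension_field_mult)
  ultimately have "card (?S \<times> ?S) \<le> card ?K"
    using fin by (rule card_inj_on_le)
  \<comment> \<open>The size hypothesis enters here; it clashes with the \<open>n\<close> distinct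
    powers of \<open>\<gamma>\<close> together with 0 lying in \<open>?S\<close>.\<close>
  then have "card ?S ^ 2 \<le> n ^ 2"
    using large by (simp add: card_extension_field assms(1) card_cartesian_product power2_eq_square)
  moreover have "n < card ?S"
  proof -
    have "\<gamma> \<noteq> 0"
      using pow assms(2) by (auto simp: zero_power)
    then have "card (insert 0 ((\<lambda>i. \<gamma> ^ i) ` {..<n})) = Suc n"
      by (subst card_insert_disjoint) (auto simp: card_image inj)
    moreover have "insert 0 ((\<lambda>i. \<gamma> ^ i) ` {..<n}) \<subseteq> ?S"
      using powers diff[OF one one] by auto
    ultimately show ?thesis
      using card_mono[of ?S] \<open>?S \<subseteq> ?K\<close> fin by (metis Suc_le_lessD finite_subset)
  qed
  ultimately show False
    by (simp add: power2_nat_le_eq_le)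
qed

section \<open>Size of a preimage under evaluation\<close>

text \<open>A counting form of rank-nullity: fibres are translates of the kernel \<open>?Z\<close>,
  so the preimage has at most \<open>card ?Z * card W\<close> elements, while
  \<open>card ?Z * q ^ N\<close> is at most \<open>q ^ n\<close>.\<close>

lemma card_eval_vec_preimage_le:
  fixes \<gamma> :: "'a :: {field, finite} alg_closure"
  assumes "N > 0" and surj: "eval_vec \<gamma> ` carrier_vec n = extension_field N"
    and W: "W \<subseteq> extension_field N"
  shows "card {v \<in> carrier_vec n. eval_vec \<gamma> v \<in> W} * CARD('a) ^ N \<le> CARD('a) ^ n * card W"
proof -
  let ?U = "{v \<in> carrier_vec n. eval_vec \<gamma> v \<in> W}"
  let ?Z = "{v \<in> carrier_vec n. eval_vec \<gamma> v = 0}"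
  let ?K = "extension_field N :: 'a alg_closure set"
  \<comment> \<open>A set-theoretic section of the evaluation map, choosing one representative in
    each fibre.\<close>
  define s where "s = inv_into (carrier_vec n) (eval_vec \<gamma>)"
  have s: "s x \<in> carrier_vec n" "eval_vec \<gamma> (s x) = x" if "x \<in> ?K" for x
    using that surj by (auto simp: s_def inv_into_into f_inv_into_f)
  have fin: "finite ?K"
    by (rule card_ge_0_finite) (simp add: card_extension_field assms(1))
  have finZ: "finite ?Z"
    using finite_carrier_vec by (rule rev_finite_subset) auto
  have "?U \<subseteq> (\<lambda>(z, w). z + s w) ` (?Z \<times> W)"
  proof
    fix u
    assume "u \<in> ?U"
    then have u: "u \<in> carrier_vec n" "eval_vec \<gamma> u \<in> W"
      by auto
    note su = s[of "eval_vec \<gamma> u"]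
    let ?z = "u + (-1) \<cdot>\<^sub>v s (eval_vec \<gamma> u)"
    have "?z \<in> ?Z"
      using su u W by (auto simp: eval_vec_add[of _ n] eval_vec_smult)
    moreover have "u = ?z + s (eval_vec \<gamma> u)"
      using su u W by (intro eq_vecI) auto
    ultimately show "u \<in> (\<lambda>(z, w). z + s w) ` (?Z \<times> W)"
      using u by (intro image_eqI[of _ _ "(?z, eval_vec \<gamma> u)"]) auto
  qed
  then have "card ?U \<le> card (?Z \<times> W)"
    using finZ finite_subset[OF W fin] by (intro surj_card_le) auto
  then have U: "card ?U \<le> card ?Z * card W"
    by (simp add: card_cartesian_product)
  have eval_sum: "eval_vec \<gamma> (z + s w) = w" if "z \<in> ?Z" "w \<in> ?K" for z w
    using that s[of w] by (simp add: eval_vec_add[of _ n])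
  have cancel: "z = z'" if "z + s w = z' + s w" "z \<in> ?Z" "z' \<in> ?Z" "w \<in> ?K" for z z' w
  proof -
    have dims: "dim_vec z = n" "dim_vec z' = n" "dim_vec (s w) = n"
      using that(2,3) s(1)[OF that(4)] by auto
    show ?thesis
    proof (rule eq_vecI)
      fix i
      assume "i < dim_vec z'"
      then have "vec_index z i + vec_index (s w) i = vec_index z' i + vec_index (s w) i"
        using dims by (simp only: that(1) flip: index_add_vec(1))
      then show "vec_index z i = vec_index z' i"
        by simp
    qed (simp add: dims)
  qed
  \<comment> \<open>Evaluating \<open>z + s w\<close> recovers \<open>w\<close>, and then cancelling
    \<open>s w\<close> recovers \<open>z\<close>.\<close>
  have "card (?Z \<times> ?K) \<le> card (carrier_vec n :: 'a vec set)"
  proof (rule card_inj_on_le[of "\<lambda>(z, w). z + s w"])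
    show "inj_on (\<lambda>(z, w). z + s w) (?Z \<times> ?K)"
    proof (rule inj_onI)
      fix a b
      assume *: "a \<in> ?Z \<times> ?K" "b \<in> ?Z \<times> ?K"
        "(case a of (z, w) \<Rightarrow> z + s w) = (case b of (z, w) \<Rightarrow> z + s w)"
      obtain z w z' w' where ab: "a = (z, w)" "b = (z', w')"
        by (cases a, cases b)
      have "w = w'"
        using eval_sum[of z w] eval_sum[of z' w'] * ab by simp
      moreover have "z = z'"
        using * ab \<open>w = w'\<close> by (intro cancel[of z w z']) auto
      ultimately show "a = b"
        using ab by simp
    qed
  qed (use s in \<open>auto simp: finite_carrier_vec\<close>)
  then have "card ?Z * CARD('a) ^ N \<le> CARD('a) ^ n"
    by (simp add: card_cartesian_product card_extension_field assms(1) card_carrier_vec)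
  then have "card ?Z * CARD('a) ^ N * card W \<le> CARD('a) ^ n * card W"
    by (rule mult_right_mono) simp
  moreover have "card ?U * CARD('a) ^ N \<le> card ?Z * card W * CARD('a) ^ N"
    using U by (rule mult_right_mono) simp
  ultimately show ?thesis
    by (simp only: mult.assoc mult.commute[of "card W"])
qed

section \<open>The covering subspace\<close>

text \<open>The construction for general parameters; \<open>t\<close> is the index of the group
  generated by \<open>\<gamma>\<close> in the multiplicative group of the field. The additive form
  avoids truncation of \<open>N - t\<close>.\<close>

lemma max_cyclic_codim_ge_diff:
  assumes "N > 0" "n * t = CARD('a :: {field, finite}) ^ N - 1" "CARD('a) ^ N \<le> n ^ 2"
  shows "N \<le> max_cyclic_codim TYPE('a) n + t"
proof -
  let ?Q = "CARD('a) ^ N"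
  let ?K = "extension_field N :: 'a alg_closure set"
  have "CARD('a) ^ N > 1"
    using one_less_card_field assms(1) by (rule one_less_power)
  then have pos: "n > 0" "t > 0"
    using assms(2) by (auto intro!: Nat.gr0I)
  obtain g :: "'a alg_closure" where gen: "?K - {0} = range (\<lambda>i. g ^ i)"
    using extension_field_generator[OF assms(1)] .
  note g_pow = extension_field_generator_inj[OF assms(1) gen]
  have "g ^ 1 \<in> ?K - {0}"
    unfolding gen by blast
  then have g: "g \<in> ?K" "g \<noteq> 0"
    by auto
  define \<gamma> where "\<gamma> = g ^ t"
  have \<gamma>: "\<gamma> \<in> ?K" "\<gamma> \<noteq> 0"
    using g by (auto simp: \<gamma>_def extension_field_power)
  have \<gamma>_pow: "\<gamma> ^ n = 1"
    using g_pow(1) by (simp add: \<gamma>_def assms(2) mult.commute flip: power_mult)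
  have "inj_on (\<lambda>i. \<gamma> ^ i) {..<n}"
  proof (rule inj_onI)
    fix i j
    assume ij: "i \<in> {..<n}" "j \<in> {..<n}" "\<gamma> ^ i = \<gamma> ^ j"
    then have "g ^ (t * i) = g ^ (t * j)"
      by (simp add: \<gamma>_def power_mult)
    \<comment> \<open>Exponents below \<open>t * n = ?Q - 1\<close> fall in the range where powers
      of \<open>g\<close> are distinct.\<close>
    moreover have "t * i < ?Q - 1" "t * j < ?Q - 1"
      using ij pos by (simp_all only: lessThan_iff mult.commute[of t] mult_less_cancel2
          flip: assms(2))
    ultimately have "t * i = t * j"
      using inj_onD[OF g_pow(2), of "t * i" "t * j"] by (simp del: mult_cancel1)
    then show "i = j"
      using pos by simp
  qed
  then have surj: "eval_vec \<gamma> ` carrier_vec n = ?K"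
    using eval_vec_image_eq_extension_field[of N n \<gamma>] assms pos \<gamma> \<gamma>_pow by simp
  define W where "W = eval_vec g ` carrier_vec t"
  define U where "U = {v \<in> carrier_vec n. eval_vec \<gamma> v \<in> W}"
  have "W \<subseteq> ?K"
    using g by (auto simp: W_def intro: eval_vec_in_extension_field)
  have W_zero: "0 \<in> W"
    unfolding W_def by (rule image_eqI[of _ _ "0\<^sub>v t"]) auto
  have W_add: "a + b \<in> W" if "a \<in> W" "b \<in> W" for a b
    using that by (auto simp: W_def simp flip: eval_vec_add)
  have W_scale: "to_ac c * a \<in> W" if "a \<in> W" for a c
    using that by (auto simp: W_def simp flip: eval_vec_smult)
  have W_power: "g ^ j \<in> W" if "j < t" for j
    unfolding W_def using that
    by (intro image_eqI[of _ _ "unit_vec t j"]) (simp_all add: eval_vec_unit)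
  have subspace: "VectorSpace.subspace class_ring U (module_vec TYPE('a) n)"
    unfolding VectorSpace.subspace_def submodule_def
    using vec_vs[where 'a = 'a] vec_module[where 'a = 'a]
    by (auto simp: module_vec_simps U_def W_zero W_add W_scale eval_vec_add[of _ n] eval_vec_smult)
  have cover: "\<exists>r<n. \<exists>u\<in>U. v = (cyclic_shift ^^ r) u" if v: "v \<in> carrier_vec n" for v
  proof (cases "eval_vec \<gamma> v = 0")
    case True
    then show ?thesis
      using v W_zero pos by (intro exI[of _ 0]) (auto simp: U_def)
  next
    case False
    then have "eval_vec \<gamma> v \<in> ?K - {0}"
      using v surj by blast
    then obtain i where i: "eval_vec \<gamma> v = g ^ i"
      unfolding gen by blast
    \<comment> \<open>Division of \<open>i\<close> by \<open>t\<close> splits \<open>g ^ i\<close>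
      into a power of \<open>\<gamma>\<close> and some \<open>g ^ j\<close> with
      \<open>j < t\<close>; the former exponent matters only modulo \<open>n\<close>.\<close>
    define r where "r = (i div t) mod n"
    have "\<gamma> ^ (i div t) = \<gamma> ^ (n * (i div t div n) + r)"
      by (simp add: r_def)
    also have "\<dots> = \<gamma> ^ r"
      by (simp only: power_add power_mult \<gamma>_pow) simp
    finally have "\<gamma> ^ r * g ^ (i mod t) = g ^ (t * (i div t) + i mod t)"
      by (simp only: power_add) (simp add: \<gamma>_def power_mult)
    then have v_eq: "eval_vec \<gamma> v = \<gamma> ^ r * g ^ (i mod t)"
      using i by simp
    have "r < n"
      using pos by (simp add: r_def)
    \<comment> \<open>The \<open>n - r\<close> shifts cancel the factor \<open>\<gamma> ^ r\<close>,
      leaving a value in \<open>W\<close>; \<open>r\<close> further shifts complete the cycle back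
      to \<open>v\<close>.\<close>
    define u where "u = (cyclic_shift ^^ (n - r)) v"
    have "eval_vec \<gamma> u = \<gamma> ^ (n - r) * \<gamma> ^ r * g ^ (i mod t)"
      using v by (simp add: u_def eval_vec_funpow_cyclic_shift[OF \<gamma>_pow] v_eq)
    also have "\<gamma> ^ (n - r) * \<gamma> ^ r = 1"
      using \<open>r < n\<close> by (simp add: \<gamma>_pow flip: power_add)
    finally have "u \<in> U"
      using W_power pos v by (simp add: U_def u_def funpow_cyclic_shift_carrier)
    moreover have "(cyclic_shift ^^ r) u = (cyclic_shift ^^ (r + (n - r))) v"
      by (simp only: u_def funpow_add comp_apply)
    then have "(cyclic_shift ^^ r) u = v"
      using \<open>r < n\<close> v by (simp add: funpow_cyclic_shift_dim)
    ultimately show ?thesis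
      using \<open>r < n\<close> by metis
  qed
  have "cyclically_covering n U"
    unfolding cyclically_covering_def
  proof (intro conjI subspace subset_antisym subsetI)
    fix v assume "v \<in> (\<Union>r\<in>{0..<n}. (cyclic_shift ^^ r) ` U)"
    then show "v \<in> carrier_vec n"
      by (auto simp: U_def funpow_cyclic_shift_carrier)
  next
    fix v :: "'a vec"
    assume "v \<in> carrier_vec n"
    then show "v \<in> (\<Union>r\<in>{0..<n}. (cyclic_shift ^^ r) ` U)"
      using cover[of v] by auto
  qed
  then have codim: "codim_vec n U \<le> max_cyclic_codim TYPE('a) n"
    by (rule max_cyclic_codim_ge)
  define e where "e = vectorspace.dim (class_ring :: 'a ring) ((module_vec TYPE('a) n)\<lparr>carrier := U\<rparr>)"
  \<comment> \<open>As \<open>W\<close> is the image of vectors of length \<open>t\<close>, its size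
    is at most \<open>q ^ t\<close>; comparing exponents then bounds the dimension
    \<open>e\<close>.\<close>
  have "CARD('a) ^ e * ?Q \<le> CARD('a) ^ n * card W"
    using card_eval_vec_preimage_le[OF assms(1) surj \<open>W \<subseteq> ?K\<close>] card_subspace[OF subspace]
    by (simp add: U_def[symmetric] e_def)
  also have "card W \<le> CARD('a) ^ t"
    unfolding W_def card_carrier_vec[symmetric] by (intro card_image_le finite_carrier_vec)
  finally have "CARD('a) ^ (e + N) \<le> CARD('a) ^ (n + t)"
    by (simp add: power_add)
  then have "e + N \<le> n + t"
    using power_le_imp_le_exp[OF one_less_card_field] by blast
  then show ?thesis
    using codim by (simp add: codim_vec_def e_def[symmetric])
qed

section \<open>Arithmetic of the parameters and the final bound\<close>

lemma sum_powers_nat: "(x - 1) * (\<Sum>i<n. x ^ i) = x ^ n - 1" for x :: nat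
proof (cases "x = 0")
  case False
  then have "x ^ n \<ge> 1"
    by simp
  have "int ((x - 1) * (\<Sum>i<n. x ^ i)) = int (x ^ n - 1)"
    using False power_diff_1_eq[of "int x" n] by (simp add: of_nat_diff)
  then show ?thesis
    by (simp only: of_nat_eq_iff)
qed (cases n; simp)

theorem theorem3p3:
  fixes q k d M c :: nat
  assumes "CARD('a :: {field, finite}) = q"
    and "k \<ge> 1"
    and "M = (q - 1) * (\<Sum>r = 0..d. q ^ (k * r))"
    and "c dvd M"
    and "real c < (real q - 1) * (real q ^ k - real q powi (- int (k * d))) / (real q ^ k - 1)"
  shows "real (max_cyclic_codim TYPE('a) (M div c))
           \<ge> real (k * d + k) - real c * (real q ^ k - 1) / (real q - 1)"
proof -
  define n where "n = M div c"
  define N where "N = k * d + k"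
  \<comment> \<open>The quotient \<open>(q ^ k - 1) / (q - 1)\<close> is written as a geometric sum,
    making \<open>t\<close> a natural number by definition.\<close>
  define t where "t = c * (\<Sum>r<k. q ^ r)"
  have q: "q > 1"
    using one_less_card_field[where 'a = 'a] assms(1) by simp
  \<comment> \<open>The summand at \<open>r = 0\<close> is 1, which makes \<open>M\<close>, and with
    it \<open>c\<close>, positive.\<close>
  have "q ^ (k * 0) \<le> (\<Sum>r = 0..d. q ^ (k * r))"
    by (rule member_le_sum) auto
  then have "M > 0"
    using q assms(3) by simp
  then have "c > 0" "n * c = M"
    using assms(4) by (auto simp: n_def)
  have qk: "q ^ k > 1"
    using q assms(2) by (intro one_less_power) auto
  \<comment> \<open>The sum defining \<open>M\<close> is geometric with ratio \<open>q ^ k\<close>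
    and \<open>d + 1\<close> terms.\<close>
  have M: "M * (q ^ k - 1) = (q - 1) * (q ^ N - 1)"
    using sum_powers_nat[of "q ^ k" "Suc d"]
    by (simp add: assms(3) N_def lessThan_Suc_atMost atMost_atLeast0 power_add mult_ac
        flip: power_mult)
  have geo: "(q - 1) * (\<Sum>r<k. q ^ r) = q ^ k - 1"
    by (rule sum_powers_nat)
  have nt: "n * t = q ^ N - 1"
  proof -
    have "(q - 1) * (n * t) = M * (q ^ k - 1)"
      unfolding t_def \<open>n * c = M\<close>[symmetric] geo[symmetric] by (simp only: mult_ac)
    then show ?thesis
      using M q by simp
  qed
  have t_real: "real t = real c * (real q ^ k - 1) / (real q - 1)"
  proof -
    have "real (q - 1) * real (\<Sum>r<k. q ^ r) = real (q ^ k - 1)"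
      by (simp only: geo flip: of_nat_mult)
    then have "(real q - 1) * real (\<Sum>r<k. q ^ r) = real q ^ k - 1"
      using q qk by (simp add: of_nat_diff)
    then show ?thesis
      using q by (simp add: t_def flip: \<open>(real q - 1) * real (\<Sum>r<k. q ^ r) = real q ^ k - 1\<close>)
  qed
  have "real (k * d + k) \<le> real (max_cyclic_codim TYPE('a) n + t)"
  proof (cases "d = 0")
    case True
    \<comment> \<open>For \<open>d = 0\<close> the target is \<open>N = k\<close>, and
      \<open>t\<close> alone reaches it: \<open>k\<close> summands of size at least 1, times
      \<open>c > 0\<close>.\<close>
    have "k = (\<Sum>r<k. 1)"
      by simp
    also have "\<dots> \<le> (\<Sum>r<k. q ^ r)"
      using q by (intro sum_mono) simp
    also have "\<dots> \<le> t"
      using \<open>c > 0\<close> by (simp add: t_def)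
    finally show ?thesis
      using True by simp
  next
    case False
    let ?x = "real q ^ (k * d)"
    have "?x > 0"
      using q by simp
    have "real q ^ k - 1 > 0"
      using qk by (simp flip: of_nat_power)
    have "real q powi (- int (k * d)) = 1 / ?x"
      by (simp only: power_int_minus power_int_of_nat inverse_eq_divide)
    \<comment> \<open>Clearing denominators turns the bound on \<open>c\<close> into
      \<open>c * (q ^ k - 1) * q ^ (k * d) < (q - 1) * (q ^ N - 1)\<close>. The right side equals
      \<open>n * c * (q ^ k - 1)\<close>, so \<open>q ^ (k * d) < n\<close>.\<close>
    then have "real c * (real q ^ k - 1) < (real q - 1) * (real q ^ k - 1 / ?x)"
      using assms(5) by (simp only: pos_less_divide_eq[OF \<open>real q ^ k - 1 > 0\<close>])
    then have "real c * (real q ^ k - 1) * ?x < (real q - 1) * (real q ^ k - 1 / ?x) * ?x"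
      using \<open>?x > 0\<close> by (rule mult_strict_right_mono)
    also have "\<dots> = (real q - 1) * (real q ^ N - 1)"
      using \<open>?x > 0\<close> by (simp add: N_def power_add algebra_simps)
    also have "\<dots> = real ((q - 1) * (q ^ N - 1))"
      using q by (simp add: of_nat_diff)
    also have "\<dots> = real n * real c * (real q ^ k - 1)"
      unfolding M[symmetric] \<open>n * c = M\<close>[symmetric] using qk by (simp add: of_nat_diff)
    finally have "?x < real n"
      using \<open>c > 0\<close> \<open>real q ^ k - 1 > 0\<close> by (simp add: mult.commute mult.left_commute)
    then have less: "q ^ (k * d) < n"
      by (simp flip: of_nat_power)
    \<comment> \<open>With \<open>d\<close> positive, \<open>N = k * d + k\<close> is at most
      \<open>2 * k * d\<close>, so \<open>q ^ N\<close> is at most the square of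
      \<open>q ^ (k * d)\<close>.\<close>
    have "k * 1 \<le> k * d"
      using False by (intro mult_le_mono2) simp
    then have "q ^ N \<le> q ^ (k * d + k * d)"
      using q by (intro power_increasing) (simp_all add: N_def)
    also have "\<dots> \<le> n ^ 2"
      unfolding power_add power2_eq_square using less by (intro mult_le_mono) simp_all
    finally have "q ^ N \<le> n ^ 2" .
    then have "N \<le> max_cyclic_codim TYPE('a) n + t"
      using assms(1,2) nt by (intro max_cyclic_codim_ge_diff) (auto simp: N_def)
    then show ?thesis
      unfolding N_def of_nat_le_iff .
  qed
  then show ?thesis
    by (simp add: t_real n_def)
qed

end
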